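(* Let $N\ge D$, let $X\in\mathbb{R}^{N\times D}$ be a full-rank data matrix (i.e. $\operatorname{rank}X=D$) with labels $\mathbf{y}\in\{-1,+1\}^N$, such that the dataset is linearly separable, i.e. there is $\boldsymbol{\beta}^*\in\mathbb{R}^D$ with $y_n\mathbf{x}_n^\top\boldsymbol{\beta}^*\ge 1$ for all $n$, where $\mathbf{x}_n^\top$ are the rows of $X$. Let $A\in\mathbb{R}^{D\times D}$ be invertible. Let $\boldsymbol{\beta}_t$, $t\in[0,T)$, be the trajectory of natural gradient flow for the linear classifier under logistic loss on data $(X,\mathbf{y})$, and let $\boldsymbol{\beta}'_t$, $t\in[0,T)$, be the trajectory of natural gradient flow for the linear classifier under logistic loss on the transformed data $(XA^\top,\mathbf{y})$ (so $\mathbf{x}_n$ is replaced by $A\mathbf{x}_n$). Assume the initial conditions are equivalent, i.e. $\boldsymbol{\beta}_0=A^\top\boldsymbol{\beta}'_0$. Then $$A^\top\boldsymbol{\beta}'_t=\boldsymbol{\beta}_t\qquad\text{for all }t\in[0,T).$$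
   Context: For a dataset $(Z,\mathbf{y})$ with $Z\in\mathbb{R}^{N\times D}$ having rows $\mathbf{z}_1^\top,\dots,\mathbf{z}_N^\top$ and $\mathbf{y}\in\{-1,+1\}^N$, the linear logistic model with parameter $\boldsymbol{\beta}\in\mathbb{R}^D$ is $p(y\mid\mathbf{z},\boldsymbol{\beta})=\frac{1}{1+e^{-y\mathbf{z}^\top\boldsymbol{\beta}}}$ for $y\in\{-1,+1\}$. Put $\ell(\boldsymbol{\beta},\mathbf{z},y)=-\log p(y\mid\mathbf{z},\boldsymbol{\beta})=\log(1+e^{-y\mathbf{z}^\top\boldsymbol{\beta}})$. The loss is $\mathcal{L}(\boldsymbol{\beta})=\sum_{n=1}^N\ell(\boldsymbol{\beta},\mathbf{z}_n,y_n)$. The (average) Fisher information matrix, averaged over the training inputs, is $$F(\boldsymbol{\beta})=\frac1N\sum_{n=1}^N\mathbb{E}_{y\sim p(\cdot\mid\mathbf{z}_n,\boldsymbol{\beta})}\left[\nabla_{\boldsymbol{\beta}}\ell(\boldsymbol{\beta},\mathbf{z}_n,y)\,\nabla_{\boldsymbol{\beta}}\ell(\boldsymbol{\beta},\mathbf{z}_n,y)^\top\right].$$ A trajectory of natural gradient flow (NGF) on $(Z,\mathbf{y})$ is a differentiable curve $\boldsymbol{\beta}_t$ satisfying $F(\boldsymbol{\beta}_t)\dot{\boldsymbol{\beta}}_t=-\nabla_{\boldsymbol{\beta}}\mathcal{L}(\boldsymbol{\beta}_t)$. *)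

theory Defs
  imports "HOL-Analysis.Analysis"
begin

definition gradient :: "('a::real_inner \<Rightarrow> real) \<Rightarrow> 'a \<Rightarrow> 'a" where
  "gradient f x = (THE d. GDERIV f x :> d)"

lemma gradient_eqI:
  assumes "GDERIV f x :> d"
  shows "gradient f x = d"
proof -
  have "e = d" if "GDERIV f x :> e" for e
  proof -
    have "(\<lambda>h. h \<bullet> e) = (\<lambda>h. h \<bullet> d)"
      using that assms unfolding gderiv_def by (rule has_derivative_unique)
    then have "(e - d) \<bullet> e = (e - d) \<bullet> d"
      by meson
    then have "(e - d) \<bullet> (e - d) = 0"
      by (subst inner_diff_right) simp
    then show "e = d"
      by simp
  qed
  with assms show ?thesis
    unfolding gradient_def by blast
qed

definition outer_product :: "real^'d \<Rightarrow> real^'d \<Rightarrow> real^'d^'d" where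
  "outer_product u v = (\<chi> i j. u $ i * v $ j)"

(* Labels are the real numbers -1 and 1; the inputs of a dataset Z are the rows of Z. *)

definition logistic_prob :: "real \<Rightarrow> real^'d \<Rightarrow> real^'d \<Rightarrow> real" where
  "logistic_prob y z \<beta> = 1 / (1 + exp (- y * (z \<bullet> \<beta>)))"

definition logistic_loss :: "real^'d \<Rightarrow> real^'d \<Rightarrow> real \<Rightarrow> real" where
  "logistic_loss \<beta> z y = - ln (logistic_prob y z \<beta>)"

definition total_loss :: "real^'d^'n \<Rightarrow> real^'n \<Rightarrow> real^'d \<Rightarrow> real" where
  "total_loss Z y \<beta> = (\<Sum>n\<in>UNIV. logistic_loss \<beta> (row n Z) (y $ n))"

(* The inner sum is the expectation over a label c drawn from the model at the n-th input;
   the observed labels do not enter. *)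
definition fisher_information :: "real^'d^'n \<Rightarrow> real^'d \<Rightarrow> real^'d^'d" where
  "fisher_information Z \<beta> =
     (1 / real CARD('n)) *\<^sub>R
       (\<Sum>n\<in>UNIV. \<Sum>c\<in>{-1, 1}.
          logistic_prob c (row n Z) \<beta> *\<^sub>R
            outer_product (gradient (\<lambda>b. logistic_loss b (row n Z) c) \<beta>)
                          (gradient (\<lambda>b. logistic_loss b (row n Z) c) \<beta>))"

(* The horizon T is extended real, so T = \<infinity> is allowed.
   The derivative at time 0 is one-sided. *)
definition ngf_trajectory ::
    "real^'d^'n \<Rightarrow> real^'n \<Rightarrow> ereal \<Rightarrow> (real \<Rightarrow> real^'d) \<Rightarrow> bool" where
  "ngf_trajectory Z y T \<beta> \<longleftrightarrow>
     (\<forall>t. 0 \<le> t \<and> ereal t < T \<longrightarrow>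
        (\<exists>v. (\<beta> has_vector_derivative v) (at t within {s. 0 \<le> s \<and> ereal s < T}) \<and>
             fisher_information Z (\<beta> t) *v v = - gradient (total_loss Z y) (\<beta> t)))"

definition linearly_separable :: "real^'d^'n \<Rightarrow> real^'n \<Rightarrow> bool" where
  "linearly_separable Z y \<longleftrightarrow> (\<exists>\<beta>. \<forall>n. y $ n * (row n Z \<bullet> \<beta>) \<ge> 1)"

end

theory Submission
  imports Defs
begin

text \<open>
  The Fisher information is \<open>1/N\<close> times the Hessian of the loss, so natural gradient flow is
  Newton flow: along a trajectory the loss gradient \<open>g\<close> satisfies \<open>g' = -N g\<close>, hence
  \<open>g(t) = exp (-N t) g(0)\<close>. As the rows of \<open>X\<close> span, the loss gradient is strictly
  monotone and therefore injective, so the initial value determines the trajectory, without any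
  appeal to uniqueness theory for differential equations. Finally \<open>A\<^sup>T \<beta>'\<close> is a
  trajectory on the original data, because the Fisher information and the loss gradient transform
  covariantly.
\<close>

section \<open>Sigmoid function and gradient of the logistic loss\<close>

definition sigmoid :: "real \<Rightarrow> real" where
  "sigmoid u = 1 / (1 + exp (- u))"

lemma one_plus_exp_nonzero [simp]: "1 + exp (u::real) \<noteq> 0"
  by (metis add_pos_pos exp_gt_zero less_numeral_extra(1) less_irrefl)

lemma sigmoid_uminus: "sigmoid (- u) = 1 - sigmoid u"
  by (simp add: sigmoid_def exp_minus field_simps)

lemma has_real_derivative_sigmoid:
  "(sigmoid has_real_derivative sigmoid u * (1 - sigmoid u)) (at u)"
proof -
  have "((\<lambda>u. 1 / (1 + exp (- u))) has_real_derivative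
      exp (- u) / (1 + exp (- u))\<^sup>2) (at u)"
    by (rule derivative_eq_intros refl | simp add: power2_eq_square)+
  moreover have "exp (- u) / (1 + exp (- u))\<^sup>2 = sigmoid u * (1 - sigmoid u)"
    by (simp add: sigmoid_def power2_eq_square field_simps)
  ultimately show ?thesis
    unfolding sigmoid_def[abs_def] by simp
qed

lemma sigmoid_strict_mono: "strict_mono sigmoid"
  by (intro strict_monoI) (simp add: sigmoid_def frac_less2 add_pos_pos)

lemma logistic_loss_eq: "logistic_loss \<beta> z c = ln (1 + exp (- c * (z \<bullet> \<beta>)))"
  by (simp add: logistic_loss_def logistic_prob_def ln_div add_pos_pos)

text \<open>The term \<open>(1 + c) / 2\<close> recodes the label from {-1, 1} to {0, 1}. This
  merges both labels into one formula: predicted probability of label 1, minus the recoded label,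
  times the input.\<close>

lemma GDERIV_logistic_loss:
  assumes "c \<in> {-1, 1}"
  shows "GDERIV (\<lambda>b. logistic_loss b z c) \<beta> :> (sigmoid (z \<bullet> \<beta>) - (1 + c) / 2) *\<^sub>R z"
proof -
  let ?e = "exp (- c * (z \<bullet> \<beta>))"
  have "((\<lambda>b. ln (1 + exp (- c * (z \<bullet> b)))) has_derivative
      (\<lambda>h. (- c * ?e / (1 + ?e)) * (h \<bullet> z))) (at \<beta>)"
    by (rule derivative_eq_intros refl | simp add: add_pos_pos inner_commute field_simps)+
  moreover have "- c * ?e / (1 + ?e) = sigmoid (z \<bullet> \<beta>) - (1 + c) / 2"
  proof -
    from assms consider "c = 1" | "c = -1" by blast
    then show ?thesis
    proof cases
      case 1
      then show ?thesis
        by (simp add: sigmoid_def) (simp add: field_simps)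
    next
      case 2
      then show ?thesis
        by (simp add: sigmoid_def exp_minus) (simp add: field_simps)
    qed
  qed
  ultimately show ?thesis
    by (simp only: gderiv_def logistic_loss_eq inner_scaleR_right)
qed

text \<open>Closed form of the gradient of \<open>total_loss\<close> for labels in {-1, 1}. The
  labels contribute only an offset that is constant in \<open>\<beta>\<close>, so they drop out of
  its derivatives and differences.\<close>

definition loss_gradient :: "real^'d^'n \<Rightarrow> real^'n \<Rightarrow> real^'d \<Rightarrow> real^'d" where
  "loss_gradient Z y \<beta> =
     (\<Sum>n\<in>UNIV. (sigmoid (row n Z \<bullet> \<beta>) - (1 + y $ n) / 2) *\<^sub>R row n Z)"

lemma gradient_total_loss:
  assumes "\<forall>n. y $ n \<in> {-1, 1}"
  shows "gradient (total_loss Z y) \<beta> = loss_gradient Z y \<beta>"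
proof (rule gradient_eqI)
  have "((\<lambda>b. \<Sum>n\<in>UNIV. logistic_loss b (row n Z) (y $ n)) has_derivative
      (\<lambda>h. \<Sum>n\<in>UNIV. h \<bullet> ((sigmoid (row n Z \<bullet> \<beta>) - (1 + y $ n) / 2) *\<^sub>R row n Z))) (at \<beta>)"
    using assms GDERIV_logistic_loss unfolding gderiv_def
    by (intro has_derivative_sum) blast
  then show "GDERIV (total_loss Z y) \<beta> :> loss_gradient Z y \<beta>"
    by (simp add: gderiv_def total_loss_def[abs_def] loss_gradient_def inner_sum_right)
qed

section \<open>Fisher information as the scaled derivative of the loss gradient\<close>

lemma outer_product_mult_vec: "outer_product u u *v v = (u \<bullet> v) *\<^sub>R u"
  by (simp add: vec_eq_iff outer_product_def matrix_vector_mult_def inner_vec_def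
      sum_distrib_left mult_ac)

lemma outer_product_scaleR:
  "outer_product (a *\<^sub>R u) (b *\<^sub>R v) = (a * b) *\<^sub>R outer_product u v"
  by (simp add: vec_eq_iff outer_product_def)

lemma matrix_vector_mult_sum_left: "(\<Sum>i\<in>I. M i) *v v = (\<Sum>i\<in>I. M i *v v)"
  by (induction I rule: infinite_finite_induct) (simp_all add: matrix_vector_mult_add_rdistrib)

text \<open>With p the sigmoid at an input z, the labels 1 and -1 have probabilities p and 1 - p and
  gradients (p - 1) z and p z. The expected outer product therefore has weight p (1 - p)^2 + (1 - p)
  p^2 = p (1 - p), which is the derivative of the sigmoid.\<close>

lemma fisher_information_eq:
  fixes Z :: "real^'d^'n"
  shows "fisher_information Z \<beta> = (1 / real CARD('n)) *\<^sub>R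
    (\<Sum>n\<in>UNIV. (sigmoid (row n Z \<bullet> \<beta>) * (1 - sigmoid (row n Z \<bullet> \<beta>))) *\<^sub>R
      outer_product (row n Z) (row n Z))"
proof -
  have "(\<Sum>c\<in>{-1, 1}. logistic_prob c z \<beta> *\<^sub>R
      outer_product (gradient (\<lambda>b. logistic_loss b z c) \<beta>)
                    (gradient (\<lambda>b. logistic_loss b z c) \<beta>))
    = (sigmoid (z \<bullet> \<beta>) * (1 - sigmoid (z \<bullet> \<beta>))) *\<^sub>R outer_product z z"
    for z :: "real^'d"
  proof -
    have 1: "logistic_prob 1 z \<beta> = sigmoid (z \<bullet> \<beta>)"
      by (simp add: logistic_prob_def sigmoid_def)
    have 2: "logistic_prob (-1) z \<beta> = 1 - sigmoid (z \<bullet> \<beta>)"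
      using sigmoid_uminus[of "z \<bullet> \<beta>"] by (simp add: logistic_prob_def sigmoid_def)
    have 3: "gradient (\<lambda>b. logistic_loss b z 1) \<beta> = (sigmoid (z \<bullet> \<beta>) - 1) *\<^sub>R z"
      using gradient_eqI[OF GDERIV_logistic_loss[of 1 z \<beta>]] by simp
    have 4: "gradient (\<lambda>b. logistic_loss b z (-1)) \<beta> = sigmoid (z \<bullet> \<beta>) *\<^sub>R z"
      using gradient_eqI[OF GDERIV_logistic_loss[of "-1" z \<beta>]] by simp
    show ?thesis
      by (simp add: 1 2 3 4 outer_product_scaleR flip: scaleR_add_left)
        (simp add: algebra_simps)
  qed
  then show ?thesis
    by (simp add: fisher_information_def)
qed

lemma fisher_information_mult_vec:
  fixes Z :: "real^'d^'n"
  shows "fisher_information Z \<beta> *v v = (1 / real CARD('n)) *\<^sub>R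
    (\<Sum>n\<in>UNIV. (sigmoid (row n Z \<bullet> \<beta>) * (1 - sigmoid (row n Z \<bullet> \<beta>)) * (row n Z \<bullet> v)) *\<^sub>R row n Z)"
  by (simp add: fisher_information_eq scaleR_matrix_vector_assoc[symmetric]
      matrix_vector_mult_sum_left outer_product_mult_vec)

text \<open>By the chain rule each summand contributes the sigmoid derivative p (1 - p), exactly the
  weight in the Fisher information; the factor \<open>CARD('n)\<close> undoes the averaging.\<close>

lemma loss_gradient_has_vector_derivative:
  fixes Z :: "real^'d^'n"
  assumes "(\<beta> has_vector_derivative v) (at t within S)"
  shows "((\<lambda>t. loss_gradient Z y (\<beta> t)) has_vector_derivative
    real CARD('n) *\<^sub>R (fisher_information Z (\<beta> t) *v v)) (at t within S)"
proof -
  have "((\<lambda>t. (sigmoid (row n Z \<bullet> \<beta> t) - (1 + y $ n) / 2) *\<^sub>R row n Z) has_vector_derivative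
     (sigmoid (row n Z \<bullet> \<beta> t) * (1 - sigmoid (row n Z \<bullet> \<beta> t)) * (row n Z \<bullet> v)) *\<^sub>R row n Z)
     (at t within S)" for n
  proof -
    have "((\<lambda>t. row n Z \<bullet> \<beta> t) has_real_derivative row n Z \<bullet> v) (at t within S)"
      using bounded_linear.has_vector_derivative[OF bounded_linear_inner_right assms]
      by (simp add: has_real_derivative_iff_has_vector_derivative)
    from DERIV_chain2[OF has_real_derivative_sigmoid this]
    have "((\<lambda>t. sigmoid (row n Z \<bullet> \<beta> t) - (1 + y $ n) / 2) has_real_derivative
        sigmoid (row n Z \<bullet> \<beta> t) * (1 - sigmoid (row n Z \<bullet> \<beta> t)) * (row n Z \<bullet> v)) (at t within S)"
      by (auto intro!: derivative_eq_intros)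
    from has_vector_derivative_scaleR[OF this has_vector_derivative_const]
    show ?thesis by simp
  qed
  then show ?thesis
    by (simp add: loss_gradient_def fisher_information_mult_vec has_vector_derivative_sum)
qed

section \<open>Exponential decay of the loss gradient along the flow\<close>

lemma loss_gradient_ngf:
  fixes X :: "real^'d^'n"
  assumes y: "\<forall>n. y $ n \<in> {-1, 1}" and ngf: "ngf_trajectory X y T \<beta>"
    and t: "0 \<le> t" "ereal t < T"
  shows "loss_gradient X y (\<beta> t) = exp (- real CARD('n) * t) *\<^sub>R loss_gradient X y (\<beta> 0)"
proof -
  let ?S = "{s. 0 \<le> s \<and> ereal s < T}"
  let ?N = "real CARD('n)"
  \<comment> \<open>The integrating factor \<open>exp (?N * s)\<close> turns g' = -N g into a
    vanishing derivative.\<close>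
  let ?h = "\<lambda>s. exp (?N * s) *\<^sub>R loss_gradient X y (\<beta> s)"
  \<comment> \<open>Convexity of the time domain, whether \<open>T\<close> is finite or infinite, is
    what makes a function with zero derivative within it constant.\<close>
  have S: "convex ?S"
    unfolding is_interval_convex_1[symmetric] is_interval_1
    by (auto intro: le_less_trans[where y = "ereal _"])
  have "(?h has_vector_derivative 0) (at s within ?S)" if "s \<in> ?S" for s
  proof -
    obtain v where v: "(\<beta> has_vector_derivative v) (at s within ?S)"
      and eq: "fisher_information X (\<beta> s) *v v = - loss_gradient X y (\<beta> s)"
      using ngf \<open>s \<in> ?S\<close> unfolding ngf_trajectory_def gradient_total_loss[OF y] by blast
    have g: "((\<lambda>s. loss_gradient X y (\<beta> s)) has_vector_derivative
        - (?N *\<^sub>R loss_gradient X y (\<beta> s))) (at s within ?S)"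
      using loss_gradient_has_vector_derivative[OF v, of X y] by (simp add: eq)
    have e: "((\<lambda>s. exp (?N * s)) has_real_derivative exp (?N * s) * ?N) (at s within ?S)"
      by (auto intro!: derivative_eq_intros)
    show ?thesis
      using has_vector_derivative_scaleR[OF e g] by simp
  qed
  then obtain c where "\<And>s. s \<in> ?S \<Longrightarrow> ?h s = c"
    using has_vector_derivative_zero_constant[OF S] by blast
  moreover have "0 \<in> ?S" "t \<in> ?S"
    using t by (auto intro: le_less_trans[of _ "ereal t"])
  ultimately have "?h t = ?h 0"
    by metis
  then have "exp (- ?N * t) *\<^sub>R ?h t = exp (- ?N * t) *\<^sub>R loss_gradient X y (\<beta> 0)"
    by simp
  then show ?thesis
    by (simp flip: exp_add)
qed

section \<open>Injectivity of the loss gradient and uniqueness of trajectories\<close>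

lemma inj_loss_gradient:
  fixes X :: "real^'d^'n"
  assumes "rank X = CARD('d)"
  shows "inj (loss_gradient X y)"
proof (rule injI)
  fix b c
  assume eq: "loss_gradient X y b = loss_gradient X y c"
  \<comment> \<open>Pairing the difference of the gradients with \<open>b - c\<close> cancels the
    labels and leaves terms that are nonnegative, and positive wherever the two scores differ. A
    zero sum thus forces equal scores on every row.\<close>
  let ?f = "\<lambda>n. (sigmoid (row n X \<bullet> b) - sigmoid (row n X \<bullet> c)) * (row n X \<bullet> b - row n X \<bullet> c)"
  have "(\<Sum>n\<in>UNIV. ?f n) = (loss_gradient X y b - loss_gradient X y c) \<bullet> (b - c)"
    by (simp add: loss_gradient_def inner_diff_right inner_sum_left algebra_simps
        flip: sum_subtractf sum.distrib)
  then have sum0: "(\<Sum>n\<in>UNIV. ?f n) = 0"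
    by (simp add: eq)
  have pos: "(sigmoid u - sigmoid v) * (u - v) > 0" if "u \<noteq> v" for u v
    using that strict_monoD[OF sigmoid_strict_mono, of u v]
      strict_monoD[OF sigmoid_strict_mono, of v u]
    by (cases u v rule: linorder_cases) (auto simp: zero_less_mult_iff)
  have "?f n \<ge> 0" for n
    using pos[of "row n X \<bullet> b" "row n X \<bullet> c"]
    by (cases "row n X \<bullet> b = row n X \<bullet> c") auto
  with sum0 have "?f n = 0" for n
    by (simp add: sum_nonneg_eq_0_iff)
  then have "row n X \<bullet> b = row n X \<bullet> c" for n
    using pos by (metis less_irrefl)
  then have "X *v b = X *v c"
    by (simp add: vec_eq_iff matrix_vector_mul_component row_def)
  then show "b = c"
    using assms full_rank_injective injD by metis
qed

lemma ngf_trajectory_unique: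
  fixes X :: "real^'d^'n"
  assumes "rank X = CARD('d)" "\<forall>n. y $ n \<in> {-1, 1}"
    and "ngf_trajectory X y T \<beta>" "ngf_trajectory X y T \<gamma>" "\<beta> 0 = \<gamma> 0"
    and "0 \<le> t" "ereal t < T"
  shows "\<beta> t = \<gamma> t"
  using assms loss_gradient_ngf injD[OF inj_loss_gradient] by metis

section \<open>Change of coordinates by \<open>A\<close>\<close>

lemma row_mult_transpose: "row n (X ** transpose A) = A *v row n X"
  for A :: "real^'d^'d"
  by (simp add: vec_eq_iff row_def matrix_matrix_mult_def matrix_vector_mult_def transpose_def
      mult.commute)

lemma inner_matrix_vector_mult: "(A *v u) \<bullet> v = u \<bullet> (v v* A)" for A :: "real^'d^'e"
  by (metis dot_lmul_matrix inner_commute)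

lemma matrix_vector_mult_sum_right: "A *v (\<Sum>i\<in>I. f i) = (\<Sum>i\<in>I. A *v f i)"
  for A :: "real^'d^'e"
  by (rule linear_sum) simp

text \<open>Moving \<open>A\<close> across the inner product shows that the transformed data at
  \<open>b\<close> give the same scores as the original data at \<open>transpose A *v b\<close>; the
  remaining factor \<open>A\<close> comes from the rows outside the sigmoid.\<close>

lemma loss_gradient_transform:
  "loss_gradient (X ** transpose A) y b = A *v loss_gradient X y (transpose A *v b)"
  for A :: "real^'d^'d"
  by (simp add: loss_gradient_def row_mult_transpose matrix_vector_mult_sum_right
      matrix_vector_mult_scaleR inner_matrix_vector_mult)

text \<open>The matrix becomes A F A^T. Applied to a velocity, the right factor yields the velocity
  of the curve \<open>transpose A *v \<beta> t\<close>, and the left factor matches the one in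
  \<open>loss_gradient_transform\<close>.\<close>

lemma fisher_information_transform:
  "fisher_information (X ** transpose A) b *v v =
    A *v (fisher_information X (transpose A *v b) *v (transpose A *v v))"
  for A :: "real^'d^'d"
  by (simp add: fisher_information_mult_vec row_mult_transpose matrix_vector_mult_sum_right
      matrix_vector_mult_scaleR inner_matrix_vector_mult)

text \<open>Reduces the comparison of flows on two datasets to uniqueness on one.\<close>

lemma ngf_trajectory_transform:
  fixes A :: "real^'d^'d"
  assumes y: "\<forall>n. y $ n \<in> {-1, 1}" and A: "invertible A"
    and ngf: "ngf_trajectory (X ** transpose A) y T \<beta>"
  shows "ngf_trajectory X y T (\<lambda>t. transpose A *v \<beta> t)"
  unfolding ngf_trajectory_def gradient_total_loss[OF y]
proof (intro allI impI)
  fix t assume t: "0 \<le> t \<and> ereal t < T"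
  let ?S = "{s. 0 \<le> s \<and> ereal s < T}"
  obtain v where v: "(\<beta> has_vector_derivative v) (at t within ?S)"
    and eq: "fisher_information (X ** transpose A) (\<beta> t) *v v =
      - loss_gradient (X ** transpose A) y (\<beta> t)"
    using ngf t unfolding ngf_trajectory_def gradient_total_loss[OF y] by blast
  have "A *v (fisher_information X (transpose A *v \<beta> t) *v (transpose A *v v)) =
      A *v (- loss_gradient X y (transpose A *v \<beta> t))"
    using eq unfolding fisher_information_transform loss_gradient_transform
    by (simp add: vec.neg)
  \<comment> \<open>Both sides carry \<open>A\<close> on the left, which cancels because an
    invertible matrix acts injectively.\<close>
  with A have "fisher_information X (transpose A *v \<beta> t) *v (transpose A *v v) =
      - loss_gradient X y (transpose A *v \<beta> t)"
    using inj_matrix_vector_mult injD by metis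
  moreover have "((\<lambda>t. transpose A *v \<beta> t) has_vector_derivative transpose A *v v) (at t within ?S)"
    using v by (rule bounded_linear.has_vector_derivative[OF matrix_vector_mul_bounded_linear])
  ultimately show "\<exists>v. ((\<lambda>t. transpose A *v \<beta> t) has_vector_derivative v) (at t within ?S) \<and>
      fisher_information X (transpose A *v \<beta> t) *v v = - loss_gradient X y (transpose A *v \<beta> t)"
    by blast
qed

theorem theorem2:
  fixes X :: "real^'d^'n" and y :: "real^'n" and A :: "real^'d^'d"
    and \<beta> \<beta>' :: "real \<Rightarrow> real^'d" and T :: ereal
  assumes "CARD('n) \<ge> CARD('d)"
    and "rank X = CARD('d)"
    and "\<forall>n. y $ n \<in> {-1, 1}"
    and "linearly_separable X y"
    and "invertible A"
    and "ngf_trajectory X y T \<beta>"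
    and "ngf_trajectory (X ** transpose A) y T \<beta>'"
    and "\<beta> 0 = transpose A *v \<beta>' 0"
  shows "\<forall>t. 0 \<le> t \<and> ereal t < T \<longrightarrow> transpose A *v \<beta>' t = \<beta> t"
  using ngf_trajectory_unique[OF assms(2,3,6) ngf_trajectory_transform[OF assms(3,5,7)] assms(8)]
  by simp

end
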